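(* For all $p,q\in\mathbb{N}_0$ and $n\in\mathbb{N}_0$, \[ \sum_{k=0}^n\binom{p+n}{k}\binom{q+n}{n-k}H_{p+n-k}H_{q+k} =\binom{p+q+2n}{n}\Big\{\big(H_{p+q+n}^{\langle 2\rangle}-H_{p+q+2n}^{\langle 2\rangle}\big)+\big(H_{p+n}+H_{p+q+n}-H_{p+q+2n}\big)\big(H_{q+n}+H_{p+q+n}-H_{p+q+2n}\big)\Big\}. \]
   Context: $\mathbb{N}_0$ denotes the set of nonnegative integers and $\mathbb{N}$ the set of positive integers. For $l\in\mathbb{N}$ the generalized harmonic numbers are $H_0^{\langle l\rangle}=0$ and $H_n^{\langle l\rangle}=\sum_{k=1}^n\frac{1}{k^l}$ for $n\ge 1$. The classical harmonic numbers are $H_n=H_n^{\langle 1\rangle}$, so $H_0=0$ and $H_n=\sum_{k=1}^n\frac1k$. *)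

theory Defs
  imports "HOL-Analysis.Harmonic_Numbers"
begin

text \<open>Generalized harmonic numbers, with order \<open>l\<close> first and index \<open>n\<close> second. The case
  \<open>l = 1\<close> is the library's \<^const>\<open>harm\<close>, see \<open>gen_harm_1\<close>.\<close>

definition gen_harm :: "nat \<Rightarrow> nat \<Rightarrow> real" where
  "gen_harm l n = (\<Sum>k=1..n. 1 / real k ^ l)"

lemma gen_harm_0 [simp]: "gen_harm l 0 = 0"
  by (simp add: gen_harm_def)

lemma gen_harm_1: "gen_harm 1 n = harm n"
  by (simp add: gen_harm_def harm_def inverse_eq_divide)

end

theory Submission
  imports Defs "HOL-Computational_Algebra.Formal_Power_Series"
begin

text \<open>
  The identity is a mixed second derivative of the Chu--Vandermonde convolution
  \[ \sum_{k=0}^n \binom{a}{k} \binom{b}{n-k} = \binom{a+b}{n}, \]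
  which holds for real \<open>a\<close> and \<open>b\<close>. Logarithmic differentiation multiplies \<open>a gchoose k\<close> by
  \<open>\<Sum>i<k. 1 / (a - i)\<close>, and at an integer \<open>a = m \<ge> k\<close> this factor is
  \<open>harm m - harm (m - k)\<close>. Differentiating a second time on the right-hand side also
  differentiates the factor itself, and this is where second-order harmonic numbers come from.

  Put \<open>m = p + n\<close>, \<open>r = q + n\<close>, \<open>N = m + r\<close>, and let \<open>\<langle>f\<rangle>\<close> be the
  average of \<open>f k\<close> with the Vandermonde weights \<open>(m choose k) * (r choose (n - k))\<close>, whose
  total is \<open>N choose n\<close>. With the abbreviations \<open>X = harm m - harm (m - k)\<close>,
  \<open>Y = harm r - harm (r - (n - k))\<close>, \<open>D = harm N - harm (N - n)\<close> and
  \<open>E = gen_harm 2 N - gen_harm 2 (N - n)\<close>, the derivatives at \<open>a = m\<close> and \<open>b = r\<close> in \<open>a\<close>, in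
  \<open>b\<close> and in both give \<open>\<langle>X\<rangle> = D\<close>, \<open>\<langle>Y\<rangle> = D\<close> and \<open>\<langle>X * Y\<rangle> = D\<^sup>2 - E\<close>. Since the
  harmonic factors in the claim are \<open>harm m - X\<close> and \<open>harm r - Y\<close>, their product averages to
  \<open>harm m * harm r - (harm m + harm r) * D + D\<^sup>2 - E = (harm m - D) * (harm r - D) - E\<close>.
\<close>

text \<open>For \<open>l = 1\<close> this is the logarithmic derivative of \<open>a gchoose k\<close>; the case \<open>l = 2\<close> is, up
  to sign, the derivative of the case \<open>l = 1\<close>.\<close>

definition falling_recip_sum :: "nat \<Rightarrow> nat \<Rightarrow> real \<Rightarrow> real" where
  "falling_recip_sum l k a = (\<Sum>i<k. 1 / (a - real i) ^ l)"

lemma falling_recip_sum_of_nat: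
  assumes "k \<le> m"
  shows "falling_recip_sum l k (real m) = gen_harm l m - gen_harm l (m - k)"
  using assms
proof (induction k)
  case 0
  then show ?case by (simp add: falling_recip_sum_def)
next
  case (Suc k)
  have "m - k = Suc (m - Suc k)" using Suc.prems by simp
  then have "gen_harm l (m - k) = gen_harm l (m - Suc k) + 1 / real (m - k) ^ l"
    by (simp add: gen_harm_def)
  with Suc show ?case by (simp add: falling_recip_sum_def of_nat_diff)
qed

lemma DERIV_gbinomial:
  fixes a :: real
  assumes "\<And>i. i < k \<Longrightarrow> a \<noteq> real i"
  shows "((\<lambda>x. x gchoose k) has_field_derivative (a gchoose k) * falling_recip_sum 1 k a) (at a)"
  using assms
proof (induction k)
  case 0
  then show ?case by (simp add: falling_recip_sum_def)
next
  case (Suc k)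
  have rec: "x gchoose Suc k = (x gchoose k) * (x - real k) / real (Suc k)" for x :: real
    using gbinomial_mult_1[of x k] by (simp add: field_simps del: of_nat_Suc)
  have ne: "a \<noteq> real k" using Suc.prems by simp
  have "((\<lambda>x. (x gchoose k) * (x - real k) / real (Suc k)) has_field_derivative
      ((a gchoose k) * falling_recip_sum 1 k a * (a - real k) + (a gchoose k)) / real (Suc k)) (at a)"
    using Suc by (auto intro!: derivative_eq_intros simp del: of_nat_Suc)
  moreover have "((a gchoose k) * falling_recip_sum 1 k a * (a - real k) + (a gchoose k)) / real (Suc k)
      = (a gchoose Suc k) * falling_recip_sum 1 (Suc k) a"
    using ne unfolding rec by (simp add: falling_recip_sum_def field_simps del: of_nat_Suc)
  ultimately show ?case by (simp only: rec)
qed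

lemma DERIV_falling_recip_sum:
  assumes "\<And>i. i < k \<Longrightarrow> a \<noteq> real i"
  shows "(falling_recip_sum 1 k has_field_derivative - falling_recip_sum 2 k a) (at a)"
  unfolding falling_recip_sum_def
  using assms by (auto intro!: derivative_eq_intros sum.cong simp: sum_negf[symmetric] power2_eq_square)

text \<open>Both sides are derivatives in \<open>a\<close> of the Chu--Vandermonde convolution. The bound
  \<open>b > -1\<close> keeps \<open>a + b\<close> off the poles \<open>0, \<dots>, n - 1\<close>; it is strict, so that the
  identity holds on an open set of \<open>b\<close> and can be differentiated again, even when \<open>n = 0\<close>
  and \<open>b = 0\<close>.\<close>

lemma gbinomial_Vandermonde_DERIV_left:
  fixes a b :: real
  assumes a: "a \<ge> real n" and b: "b > -1"
  shows "(\<Sum>k=0..n. (a gchoose k) * falling_recip_sum 1 k a * (b gchoose (n - k)))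
       = ((a + b) gchoose n) * falling_recip_sum 1 n (a + b)"
proof -
  have "((\<lambda>x. \<Sum>k=0..n. (x gchoose k) * (b gchoose (n - k))) has_field_derivative
      (\<Sum>k=0..n. (a gchoose k) * falling_recip_sum 1 k a * (b gchoose (n - k)))) (at a)"
    by (rule DERIV_sum DERIV_cmult_right DERIV_gbinomial)+ (use a in auto)
  moreover have "((\<lambda>x. (x + b) gchoose n) has_field_derivative
      ((a + b) gchoose n) * falling_recip_sum 1 n (a + b)) (at a)"
    using a b by (subst DERIV_shift[symmetric], intro DERIV_gbinomial) auto
  ultimately show ?thesis
    unfolding gbinomial_Vandermonde by (rule DERIV_unique)
qed

lemma gbinomial_Vandermonde_DERIV_right:
  fixes a b :: real
  assumes "a > -1" and "b \<ge> real n"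
  shows "(\<Sum>k=0..n. (a gchoose k) * ((b gchoose (n - k)) * falling_recip_sum 1 (n - k) b))
       = ((a + b) gchoose n) * falling_recip_sum 1 n (a + b)"
  using gbinomial_Vandermonde_DERIV_left[OF assms(2,1)]
  by (subst sum.atLeastAtMost_rev) (simp add: ac_simps cong: sum.cong_simp)

lemma gbinomial_Vandermonde_DERIV_mixed:
  fixes a b :: real
  assumes a: "a \<ge> real n" and b: "b \<ge> real n"
  shows "(\<Sum>k=0..n. (a gchoose k) * falling_recip_sum 1 k a *
                    ((b gchoose (n - k)) * falling_recip_sum 1 (n - k) b))
       = ((a + b) gchoose n) *
           ((falling_recip_sum 1 n (a + b))\<^sup>2 - falling_recip_sum 2 n (a + b))"
proof -
  have "((\<lambda>y. \<Sum>k=0..n. (a gchoose k) * falling_recip_sum 1 k a * (y gchoose (n - k)))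
      has_field_derivative
      (\<Sum>k=0..n. (a gchoose k) * falling_recip_sum 1 k a *
                 ((b gchoose (n - k)) * falling_recip_sum 1 (n - k) b))) (at b)"
    by (rule DERIV_sum DERIV_cmult DERIV_gbinomial)+ (use b in auto)
  \<comment> \<open>The once-differentiated identity holds in a neighbourhood of \<open>b\<close>, so its left-hand side
      may be replaced before differentiating.\<close>
  then have "((\<lambda>y. ((y + a) gchoose n) * falling_recip_sum 1 n (y + a)) has_field_derivative
      (\<Sum>k=0..n. (a gchoose k) * falling_recip_sum 1 k a *
                 ((b gchoose (n - k)) * falling_recip_sum 1 (n - k) b))) (at b)"
    by (rule has_field_derivative_transform_within_open[where S = "{-1<..}"])
       (use a b gbinomial_Vandermonde_DERIV_left in \<open>auto simp: add.commute\<close>)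
  moreover have "((\<lambda>y. ((y + a) gchoose n) * falling_recip_sum 1 n (y + a)) has_field_derivative
      ((b + a) gchoose n) * falling_recip_sum 1 n (b + a) * falling_recip_sum 1 n (b + a)
      + (- falling_recip_sum 2 n (b + a)) * ((b + a) gchoose n)) (at b)"
    unfolding DERIV_shift[where f = "\<lambda>x. (x gchoose n) * falling_recip_sum 1 n x", symmetric]
    by (intro DERIV_mult DERIV_gbinomial DERIV_falling_recip_sum) (use a b in auto)
  ultimately have "(\<Sum>k=0..n. (a gchoose k) * falling_recip_sum 1 k a *
                             ((b gchoose (n - k)) * falling_recip_sum 1 (n - k) b))
      = ((b + a) gchoose n) * falling_recip_sum 1 n (b + a) * falling_recip_sum 1 n (b + a)
        + (- falling_recip_sum 2 n (b + a)) * ((b + a) gchoose n)"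
    by (rule DERIV_unique)
  then show ?thesis
    by (simp add: algebra_simps power2_eq_square)
qed

theorem theorem3:
  fixes p q n :: nat
  shows "(\<Sum>k=0..n. real ((p + n) choose k) * real ((q + n) choose (n - k))
              * harm (p + n - k) * harm (q + k))
       = real ((p + q + 2 * n) choose n) *
           ((gen_harm 2 (p + q + n) - gen_harm 2 (p + q + 2 * n))
            + (harm (p + n) + harm (p + q + n) - harm (p + q + 2 * n))
              * (harm (q + n) + harm (p + q + n) - harm (p + q + 2 * n)))"
proof -
  define a b where "a = real (p + n)" and "b = real (q + n)"
  define A B :: real where "A = harm (p + n)" and "B = harm (q + n)"
  define X where "X k = falling_recip_sum 1 k a" for k
  define Y where "Y k = falling_recip_sum 1 (n - k) b" for k
  define C where "C = (a + b) gchoose n"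
  define D where "D = falling_recip_sum 1 n (a + b)"
  define E where "E = falling_recip_sum 2 n (a + b)"
  have ab: "a \<ge> real n" "b \<ge> real n" "a > -1" "b > -1" by (simp_all add: a_def b_def)
  have N: "a + b = real (p + q + 2 * n)" by (simp add: a_def b_def)
  have C_eq: "C = real ((p + q + 2 * n) choose n)"
    unfolding C_def N by (simp only: binomial_gbinomial)
  have diff: "p + q + 2 * n - n = p + q + n" by simp
  have D_eq: "D = harm (p + q + 2 * n) - harm (p + q + n)"
    unfolding D_def N by (subst falling_recip_sum_of_nat) (simp, simp only: diff gen_harm_1)
  have E_eq: "E = gen_harm 2 (p + q + 2 * n) - gen_harm 2 (p + q + n)"
    unfolding E_def N by (subst falling_recip_sum_of_nat) (simp, simp only: diff)
  have X_eq: "harm (p + n - k) = A - X k" if "k \<le> n" for k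
    using that by (simp add: X_def a_def A_def falling_recip_sum_of_nat gen_harm_1[simplified]
      del: of_nat_add)
  have Y_eq: "harm (q + k) = B - Y k" if "k \<le> n" for k
    using that by (simp add: Y_def b_def B_def falling_recip_sum_of_nat gen_harm_1[simplified]
      del: of_nat_add)
  let ?w = "\<lambda>k. (a gchoose k) * (b gchoose (n - k))"
  have w: "(\<Sum>k=0..n. ?w k) = C"
    by (simp add: gbinomial_Vandermonde C_def)
  have wX: "(\<Sum>k=0..n. ?w k * X k) = C * D"
    using gbinomial_Vandermonde_DERIV_left[OF ab(1,4)] by (simp add: X_def C_def D_def ac_simps)
  have wY: "(\<Sum>k=0..n. ?w k * Y k) = C * D"
    using gbinomial_Vandermonde_DERIV_right[OF ab(3,2)] by (simp add: Y_def C_def D_def ac_simps)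
  have wXY: "(\<Sum>k=0..n. ?w k * (X k * Y k)) = C * (D\<^sup>2 - E)"
    using gbinomial_Vandermonde_DERIV_mixed[OF ab(1,2)]
    by (simp add: X_def Y_def C_def D_def E_def ac_simps)
  have "(\<Sum>k=0..n. real ((p + n) choose k) * real ((q + n) choose (n - k))
              * harm (p + n - k) * harm (q + k))
      = (\<Sum>k=0..n. ?w k * (A - X k) * (B - Y k))"
    by (intro sum.cong refl) (simp add: X_eq Y_eq a_def b_def binomial_gbinomial)
  also have "\<dots> = (\<Sum>k=0..n. A * B * ?w k - B * (?w k * X k) - A * (?w k * Y k) + ?w k * (X k * Y k))"
    by (intro sum.cong refl) (simp add: algebra_simps)
  also have "\<dots> = A * B * C - B * (C * D) - A * (C * D) + C * (D\<^sup>2 - E)"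
    by (simp only: sum.distrib sum_subtractf sum_distrib_left[symmetric] w wX wY wXY)
  also have "\<dots> = C * (- E + (A - D) * (B - D))"
    by (simp add: algebra_simps power2_eq_square)
  finally show ?thesis
    by (simp add: C_eq D_eq E_eq A_def B_def algebra_simps)
qed

end
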